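(* Let $\alpha>0$ and $t_1,\dots,t_5>0$. Let $\bar u=(\bar x,\bar y,\bar z,\bar r,\bar s,\bar\lambda_1,\dots,\bar\lambda_7)$ be a point that satisfies the optimality conditions (OC). Suppose that the matrix $A$ (with $l=n$) is invertible and $\nabla^2_{xx}F(\bar x,\bar y)$ has full column rank. Furthermore, assume that the sets $P_1$, $P_3$, $P_5$, $Q_2$, and $Q_4$ (at $\bar u$) are empty. Then all the elements of $\partial\Phi^{\alpha,t}(\bar u)$ are nonsingular.
   Context: Let $D\in\mathbb{R}^{m\times n}$, $d\in\mathbb{R}^m$, $A\in\mathbb{R}^{l\times n}$, $b\in\mathbb{R}^l$, and let $F:\mathbb{R}^n\times\mathbb{R}^n\to\mathbb{R}$ be twice continuously differentiable. $\mathrm{e}$ is the vector of ones; $\max$ and vector inequalities are componentwise. The variable is $u=(x,y,z,r,s,\lambda_1,\dots,\lambda_7)\in\mathbb{R}^{3n+8l+m}$ with $x,y,\lambda_6\in\mathbb{R}^n$, $z,r,s,\lambda_2,\lambda_3,\lambda_4,\lambda_5,\lambda_7\in\mathbb{R}^l$, $\lambda_1\in\mathbb{R}^m$. Optimality conditions (OC): $$\begin{aligned} &\nabla_x F(x,y)+D^\top\lambda_1+\lambda_6=0,\quad \nabla_y F(x,y)-\alpha A^\top s+A^\top\lambda_2=0,\quad \alpha r+A\lambda_6-\lambda_3=0,\\ &\alpha z+\lambda_7-\lambda_4=0,\quad \alpha(b-Ay)+\lambda_7-\lambda_5=0,\quad A^\top z+x=0,\quad r+s-\mathrm{e}=0,\\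 &\lambda_1^\top(Dx-d)=0,\ Dx\le d,\ \lambda_1\ge0;\qquad \lambda_2^\top(b-Ay)=0,\ b-Ay\ge0,\ \lambda_2\ge0;\\ &\lambda_3^\top z=0,\ \lambda_3\ge0,\ z\ge0;\qquad \lambda_4^\top r=0,\ \lambda_4\ge0,\ r\ge0;\qquad \lambda_5^\top s=0,\ \lambda_5\ge0,\ s\ge0. \end{aligned}$$ Define $$\Phi^{\alpha,t}(u):=\begin{pmatrix} \nabla_x F(x,y)+D^\top\lambda_1+\lambda_6\\ \nabla_y F(x,y)-\alpha A^\top s+A^\top\lambda_2\\ \alpha r+A\lambda_6-\lambda_3\\ \alpha z+\lambda_7-\lambda_4\\ \alpha(b-Ay)+\lambda_7-\lambda_5\\ A^\top z+x\\ r+s-\mathrm{e}\\ \lambda_1-\max(0,\lambda_1+t_1(Dx-d))\\ \lambda_2-\max(0,\lambda_2+t_2(Ay-b))\\ \lambda_3-\max(0,\lambda_3-t_3z)\\ \lambda_4-\max(0,\lambda_4-t_4r)\\ \lambda_5-\max(0,\lambda_5-t_5s) \end{pmatrix}.$$ $\partial\Phi^{\alpha,t}(u)$ is Clarke's generalized Jacobian: the convex hull of all limits of Jacobian matrices of $\Phi^{\alpha,t}$ at points $u_k\to u$ at which $\Phi^{\alpha,t}$ is differentiable. Let $h_1:=Dx-d$, $h_2:=Ay-b$, $h_3:=-z$, $h_4:=-r$, $h_5:=-s$, and $k_1=m$, $k_2=k_3=k_4=k_5=l$. For $i=1,\dots,5$, at a point $u$, $$P_i:=\{j\in\{1,\dots,k_i\}\mid(\lambda_i+t_ih_i)_j\ge0\},\qquad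 Q_i:=\{j\in\{1,\dots,k_i\}\mid(\lambda_i+t_ih_i)_j\le0\}.$$ *)

theory Defs
  imports "HOL-Analysis.Analysis"
begin

(* The unknown u = (x,y,z,r,s,lambda_1,...,lambda_7) is a single vector whose coordinates are
   labelled by block and by position within the block, so that CARD(('n,'l,'m) uvar) = 3n+8l+m
   and Jacobians with respect to u are library matrices. *)
datatype ('n, 'l, 'm) uvar =
    Ix_x 'n
  | Ix_y 'n
  | Ix_z 'l
  | Ix_r 'l
  | Ix_s 'l
  | Ix_lam1 'm
  | Ix_lam2 'l
  | Ix_lam3 'l
  | Ix_lam4 'l
  | Ix_lam5 'l
  | Ix_lam6 'n
  | Ix_lam7 'l

(* Labels of the twelve block rows of Phi, from top to bottom. *)
datatype ('n, 'l, 'm) eqn =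
    Row1 'n
  | Row2 'n
  | Row3 'l
  | Row4 'l
  | Row5 'l
  | Row6 'n
  | Row7 'l
  | Row8 'm
  | Row9 'l
  | Row10 'l
  | Row11 'l
  | Row12 'l

lemma UNIV_uvar:
  "(UNIV :: ('n, 'l, 'm) uvar set) =
     range Ix_x \<union>
     range Ix_y \<union>
     range Ix_z \<union>
     range Ix_r \<union>
     range Ix_s \<union>
     range Ix_lam1 \<union>
     range Ix_lam2 \<union>
     range Ix_lam3 \<union>
     range Ix_lam4 \<union>
     range Ix_lam5 \<union>
     range Ix_lam6 \<union>
     range Ix_lam7"
  (is "_ = ?R")
proof -
  have "a \<in> ?R" for a
    by (cases a) simp_all
  then show ?thesis by blast
qed

instance uvar :: (finite, finite, finite) finite
  by standard (simp add: UNIV_uvar)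

lemma UNIV_eqn:
  "(UNIV :: ('n, 'l, 'm) eqn set) =
     range Row1 \<union>
     range Row2 \<union>
     range Row3 \<union>
     range Row4 \<union>
     range Row5 \<union>
     range Row6 \<union>
     range Row7 \<union>
     range Row8 \<union>
     range Row9 \<union>
     range Row10 \<union>
     range Row11 \<union>
     range Row12"
  (is "_ = ?R")
proof -
  have "a \<in> ?R" for a
    by (cases a) simp_all
  then show ?thesis by blast
qed

instance eqn :: (finite, finite, finite) finite
  by standard (simp add: UNIV_eqn)


lemma CARD_uvar:
  "CARD(('n::finite, 'l::finite, 'm::finite) uvar) = 3 * CARD('n) + 8 * CARD('l) + CARD('m)"
proof -
  have disj: "range f \<inter> range g = {}" if "\<And>i j. f i \<noteq> g j"
    for f :: "'c \<Rightarrow> ('n, 'l, 'm) uvar" and g :: "'d \<Rightarrow> ('n, 'l, 'm) uvar"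
    using that by auto
  show ?thesis
    unfolding UNIV_uvar
    by (simp add: card_Un_disjoint card_image inj_def Int_Un_distrib2 disj)
qed

lemma CARD_eqn:
  "CARD(('n::finite, 'l::finite, 'm::finite) eqn) = 3 * CARD('n) + 8 * CARD('l) + CARD('m)"
proof -
  have disj: "range f \<inter> range g = {}" if "\<And>i j. f i \<noteq> g j"
    for f :: "'c \<Rightarrow> ('n, 'l, 'm) eqn" and g :: "'d \<Rightarrow> ('n, 'l, 'm) eqn"
    using that by auto
  show ?thesis
    unfolding UNIV_eqn
    by (simp add: card_Un_disjoint card_image inj_def Int_Un_distrib2 disj)
qed

definition x_of :: "real ^ (('n::finite, 'l::finite, 'm::finite) uvar) \<Rightarrow> real ^ 'n"
  where "x_of u = (\<chi> j. u $ Ix_x j)"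

definition y_of :: "real ^ (('n::finite, 'l::finite, 'm::finite) uvar) \<Rightarrow> real ^ 'n"
  where "y_of u = (\<chi> j. u $ Ix_y j)"

definition z_of :: "real ^ (('n::finite, 'l::finite, 'm::finite) uvar) \<Rightarrow> real ^ 'l"
  where "z_of u = (\<chi> j. u $ Ix_z j)"

definition r_of :: "real ^ (('n::finite, 'l::finite, 'm::finite) uvar) \<Rightarrow> real ^ 'l"
  where "r_of u = (\<chi> j. u $ Ix_r j)"

definition s_of :: "real ^ (('n::finite, 'l::finite, 'm::finite) uvar) \<Rightarrow> real ^ 'l"
  where "s_of u = (\<chi> j. u $ Ix_s j)"

definition lam1_of :: "real ^ (('n::finite, 'l::finite, 'm::finite) uvar) \<Rightarrow> real ^ 'm"
  where "lam1_of u = (\<chi> j. u $ Ix_lam1 j)"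

definition lam2_of :: "real ^ (('n::finite, 'l::finite, 'm::finite) uvar) \<Rightarrow> real ^ 'l"
  where "lam2_of u = (\<chi> j. u $ Ix_lam2 j)"

definition lam3_of :: "real ^ (('n::finite, 'l::finite, 'm::finite) uvar) \<Rightarrow> real ^ 'l"
  where "lam3_of u = (\<chi> j. u $ Ix_lam3 j)"

definition lam4_of :: "real ^ (('n::finite, 'l::finite, 'm::finite) uvar) \<Rightarrow> real ^ 'l"
  where "lam4_of u = (\<chi> j. u $ Ix_lam4 j)"

definition lam5_of :: "real ^ (('n::finite, 'l::finite, 'm::finite) uvar) \<Rightarrow> real ^ 'l"
  where "lam5_of u = (\<chi> j. u $ Ix_lam5 j)"

definition lam6_of :: "real ^ (('n::finite, 'l::finite, 'm::finite) uvar) \<Rightarrow> real ^ 'n"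
  where "lam6_of u = (\<chi> j. u $ Ix_lam6 j)"

definition lam7_of :: "real ^ (('n::finite, 'l::finite, 'm::finite) uvar) \<Rightarrow> real ^ 'l"
  where "lam7_of u = (\<chi> j. u $ Ix_lam7 j)"


definition twice_continuously_differentiable :: "('a::real_normed_vector \<Rightarrow> real) \<Rightarrow> bool"
  where "twice_continuously_differentiable F \<longleftrightarrow>
    (\<exists>(F' :: 'a \<Rightarrow> 'a \<Rightarrow>\<^sub>L real) (F'' :: 'a \<Rightarrow> 'a \<Rightarrow>\<^sub>L ('a \<Rightarrow>\<^sub>L real)).
       (\<forall>p. (F has_derivative blinfun_apply (F' p)) (at p)) \<and>
       (\<forall>p. (F' has_derivative blinfun_apply (F'' p)) (at p)) \<and>
       continuous_on UNIV F'')"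

definition gradient :: "(real ^ 'n \<Rightarrow> real) \<Rightarrow> real ^ 'n \<Rightarrow> real ^ 'n"
  where "gradient f x = (\<chi> j. frechet_derivative f (at x) (axis j 1))"

definition grad_x :: "((real ^ 'n) \<times> (real ^ 'n) \<Rightarrow> real) \<Rightarrow> real ^ 'n \<Rightarrow> real ^ 'n \<Rightarrow> real ^ 'n"
  where "grad_x F x y = gradient (\<lambda>x'. F (x', y)) x"

definition grad_y :: "((real ^ 'n) \<times> (real ^ 'n) \<Rightarrow> real) \<Rightarrow> real ^ 'n \<Rightarrow> real ^ 'n \<Rightarrow> real ^ 'n"
  where "grad_y F x y = gradient (\<lambda>y'. F (x, y')) y"

definition hess_xx :: "((real ^ 'n) \<times> (real ^ 'n) \<Rightarrow> real) \<Rightarrow> real ^ 'n \<Rightarrow> real ^ 'n \<Rightarrow> real ^ 'n ^ 'n"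
  where "hess_xx F x y = jacobian (\<lambda>x'. grad_x F x' y) (at x)"

(* Clarke's generalized Jacobian.  The index types 'a and 'b may differ; for Phi they are uvar and
   eqn, which have the same cardinality (CARD_uvar, CARD_eqn), so the matrices are square. *)
definition clarke_jacobian ::
    "(real ^ 'a::finite \<Rightarrow> real ^ 'b::finite) \<Rightarrow> real ^ 'a \<Rightarrow> (real ^ 'a ^ 'b) set"
  where "clarke_jacobian f u = convex hull
    {J. \<exists>X :: nat \<Rightarrow> real ^ 'a. X \<longlonglongrightarrow> u \<and> (\<forall>k. f differentiable (at (X k))) \<and>
          (\<lambda>k. jacobian f (at (X k))) \<longlonglongrightarrow> J}"

(* Componentwise max(0, v).  The order on vectors is componentwise and hence only partial, so
   the overloaded max on vectors would not be this function. *)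
definition max0 :: "real ^ 'k \<Rightarrow> real ^ 'k"
  where "max0 v = (\<chi> j. max 0 (v $ j))"

(* The constant 1 of type real ^ 'l is the vector of ones e; vector inequalities are componentwise. *)
definition OC ::
    "((real ^ 'n::finite) \<times> (real ^ 'n) \<Rightarrow> real) \<Rightarrow> real ^ 'n ^ 'm::finite \<Rightarrow> real ^ 'm \<Rightarrow>
     real ^ 'n ^ 'l::finite \<Rightarrow> real ^ 'l \<Rightarrow> real \<Rightarrow> real ^ (('n, 'l, 'm) uvar) \<Rightarrow> bool"
  where "OC F D d A b \<alpha> u \<longleftrightarrow>
    (let x = x_of u; y = y_of u; z = z_of u; r = r_of u; s = s_of u;
         l1 = lam1_of u; l2 = lam2_of u; l3 = lam3_of u; l4 = lam4_of u;
         l5 = lam5_of u; l6 = lam6_of u; l7 = lam7_of u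
     in grad_x F x y + transpose D *v l1 + l6 = 0 \<and>
        grad_y F x y - \<alpha> *\<^sub>R (transpose A *v s) + transpose A *v l2 = 0 \<and>
        \<alpha> *\<^sub>R r + A *v l6 - l3 = 0 \<and>
        \<alpha> *\<^sub>R z + l7 - l4 = 0 \<and>
        \<alpha> *\<^sub>R (b - A *v y) + l7 - l5 = 0 \<and>
        transpose A *v z + x = 0 \<and>
        r + s - 1 = 0 \<and>
        l1 \<bullet> (D *v x - d) = 0 \<and> D *v x \<le> d \<and> l1 \<ge> 0 \<and>
        l2 \<bullet> (b - A *v y) = 0 \<and> b - A *v y \<ge> 0 \<and> l2 \<ge> 0 \<and>
        l3 \<bullet> z = 0 \<and> l3 \<ge> 0 \<and> z \<ge> 0 \<and>
        l4 \<bullet> r = 0 \<and> l4 \<ge> 0 \<and> r \<ge> 0 \<and>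
        l5 \<bullet> s = 0 \<and> l5 \<ge> 0 \<and> s \<ge> 0)"

(* The parameters t_1, ..., t_5 are t 1, ..., t 5; other values of t are irrelevant. *)
definition Phi ::
    "((real ^ 'n::finite) \<times> (real ^ 'n) \<Rightarrow> real) \<Rightarrow> real ^ 'n ^ 'm::finite \<Rightarrow> real ^ 'm \<Rightarrow>
     real ^ 'n ^ 'l::finite \<Rightarrow> real ^ 'l \<Rightarrow> real \<Rightarrow> (nat \<Rightarrow> real) \<Rightarrow>
     real ^ (('n, 'l, 'm) uvar) \<Rightarrow> real ^ (('n, 'l, 'm) eqn)"
  where "Phi F D d A b \<alpha> t u =
    (let x = x_of u; y = y_of u; z = z_of u; r = r_of u; s = s_of u;
         l1 = lam1_of u; l2 = lam2_of u; l3 = lam3_of u; l4 = lam4_of u;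
         l5 = lam5_of u; l6 = lam6_of u; l7 = lam7_of u
     in \<chi> e. case e of
          Row1 j \<Rightarrow> (grad_x F x y + transpose D *v l1 + l6) $ j
        | Row2 j \<Rightarrow> (grad_y F x y - \<alpha> *\<^sub>R (transpose A *v s) + transpose A *v l2) $ j
        | Row3 j \<Rightarrow> (\<alpha> *\<^sub>R r + A *v l6 - l3) $ j
        | Row4 j \<Rightarrow> (\<alpha> *\<^sub>R z + l7 - l4) $ j
        | Row5 j \<Rightarrow> (\<alpha> *\<^sub>R (b - A *v y) + l7 - l5) $ j
        | Row6 j \<Rightarrow> (transpose A *v z + x) $ j
        | Row7 j \<Rightarrow> (r + s - 1) $ j
        | Row8 j \<Rightarrow> (l1 - max0 (l1 + t 1 *\<^sub>R (D *v x - d))) $ j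
        | Row9 j \<Rightarrow> (l2 - max0 (l2 + t 2 *\<^sub>R (A *v y - b))) $ j
        | Row10 j \<Rightarrow> (l3 - max0 (l3 - t 3 *\<^sub>R z)) $ j
        | Row11 j \<Rightarrow> (l4 - max0 (l4 - t 4 *\<^sub>R r)) $ j
        | Row12 j \<Rightarrow> (l5 - max0 (l5 - t 5 *\<^sub>R s)) $ j)"

definition P_set :: "real \<Rightarrow> real ^ 'k \<Rightarrow> real ^ 'k \<Rightarrow> 'k set"
  where "P_set \<tau> w h = {j. (w + \<tau> *\<^sub>R h) $ j \<ge> 0}"

definition Q_set :: "real \<Rightarrow> real ^ 'k \<Rightarrow> real ^ 'k \<Rightarrow> 'k set"
  where "Q_set \<tau> w h = {j. (w + \<tau> *\<^sub>R h) $ j \<le> 0}"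

end

theory Submission
  imports Defs
begin

text \<open>
  Emptiness of \<open>P\<^sub>1\<close>, \<open>P\<^sub>3\<close>, \<open>P\<^sub>5\<close>, \<open>Q\<^sub>2\<close>, \<open>Q\<^sub>4\<close> makes every argument of a maximum in
  \<open>Phi\<close> strictly negative (odd indices) or strictly positive (even indices) at \<open>u\<close>. Strict signs
  persist nearby, so around \<open>u\<close> each maximum is either zero or
  equal to its argument throughout, and \<open>Phi\<close> coincides with one smooth selection
  (\<open>Phi_eq_piece\<close>). The gradients of \<open>F\<close> in the first two rows are continuously differentiable,
  hence so is \<open>Phi\<close> near \<open>u\<close>, and its Clarke Jacobian consists of the ordinary Jacobian at \<open>u\<close>
  alone (\<open>clarke_jacobian_continuously_differentiable\<close>).

  This matrix is square, its row and column labels being equally many, so it is enough that its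
  kernel is trivial (\<open>invertible_if_trivial_kernel\<close>). The active pieces are decoupled: in the
  multiplier rows they force \<open>\<lambda>\<^sub>1 = \<lambda>\<^sub>3 = \<lambda>\<^sub>5 = 0\<close>, \<open>r = 0\<close> and \<open>A y = 0\<close> for a kernel vector.
  Back substitution through the remaining rows then eliminates every block in turn, each step
  using at most injectivity of \<open>A\<close>, of its transpose, or of the Hessian block
  (\<open>Phi_piece_deriv_trivial_kernel\<close>).
\<close>

section \<open>Square matrices with distinct index types\<close>

lemma invertible_if_trivial_kernel:
  fixes M :: "real ^ 'a::finite ^ 'b::finite"
  assumes card: "CARD('a) = CARD('b)" and ker: "\<And>v. M *v v = 0 \<Longrightarrow> v = 0"
  shows "invertible M"
proof -
  have inj: "inj ((*v) M)"
    using ker matrix_vector_mul_linear[of M] by (metis linear_injective_0)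
  then have "surj ((*v) M)"
    using card by (metis full_rank_injective full_rank_surjective)
  with inj show ?thesis
    by (simp add: invertible_eq_bij bij_def)
qed

section \<open>The Clarke Jacobian at a point of continuous differentiability\<close>

text \<open>
  Near \<open>u\<close> the Jacobian is given by a function continuous at \<open>u\<close>, so every limit of Jacobians
  along a sequence tending to \<open>u\<close> is the value there; the constant sequence shows that this value
  is attained, and the convex hull of one point is that point. The sequence may start far from
  \<open>u\<close>, where \<open>M\<close> need not be the Jacobian, but only its tail affects the limit.
\<close>
lemma clarke_jacobian_continuously_differentiable:
  fixes f :: "real ^ 'a::finite \<Rightarrow> real ^ 'b::finite"
  assumes deriv: "\<forall>\<^sub>F p in nhds u. (f has_derivative (*v) (M p)) (at p)"
    and cont: "isCont M u"
  shows "clarke_jacobian f u = {M u}"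
proof -
  have jac: "\<forall>\<^sub>F p in nhds u. jacobian f (at p) = M p"
    using deriv
  proof eventually_elim
    case (elim p)
    then show ?case
      by (metis frechet_derivative_at jacobian_def matrix_of_matrix_vector_mul)
  qed
  have lim_unique: "J = M u"
    if X: "X \<longlonglongrightarrow> u" and J: "(\<lambda>k. jacobian f (at (X k))) \<longlonglongrightarrow> J" for X J
  proof -
    have "(\<lambda>k. M (X k)) \<longlonglongrightarrow> M u"
      using cont X by (rule isCont_tendsto_compose)
    moreover have "\<forall>\<^sub>F k in sequentially. jacobian f (at (X k)) = M (X k)"
      using jac X by (rule eventually_compose_filterlim)
    ultimately have "(\<lambda>k. jacobian f (at (X k))) \<longlonglongrightarrow> M u"
      by (simp add: tendsto_cong)
    then show ?thesis
      using J LIMSEQ_unique by blast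
  qed
  have "f differentiable (at u)" "jacobian f (at u) = M u"
    using eventually_nhds_x_imp_x[OF deriv] eventually_nhds_x_imp_x[OF jac]
    by (auto simp: differentiable_def)
  then have attained: "\<exists>X. X \<longlonglongrightarrow> u \<and> (\<forall>k::nat. f differentiable (at (X k))) \<and>
      (\<lambda>k. jacobian f (at (X k))) \<longlonglongrightarrow> M u"
    by (intro exI[of _ "\<lambda>_. u"]) simp
  have "{J. \<exists>X :: nat \<Rightarrow> real ^ 'a. X \<longlonglongrightarrow> u \<and> (\<forall>k. f differentiable (at (X k))) \<and>
          (\<lambda>k. jacobian f (at (X k))) \<longlonglongrightarrow> J} = {M u}"
    using lim_unique attained by blast
  then show ?thesis
    by (simp add: clarke_jacobian_def)
qed

section \<open>Calculus of the blocks of the unknown\<close>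

lemma bounded_linear_blocks:
  "bounded_linear x_of" "bounded_linear y_of" "bounded_linear z_of" "bounded_linear r_of"
  "bounded_linear s_of" "bounded_linear lam1_of" "bounded_linear lam2_of" "bounded_linear lam3_of"
  "bounded_linear lam4_of" "bounded_linear lam5_of" "bounded_linear lam6_of" "bounded_linear lam7_of"
  unfolding x_of_def y_of_def z_of_def r_of_def s_of_def lam1_of_def lam2_of_def lam3_of_def
    lam4_of_def lam5_of_def lam6_of_def lam7_of_def
  by (auto intro!: linearI simp: linear_conv_bounded_linear[symmetric] vec_eq_iff)

lemmas has_derivative_blocks [derivative_intros] =
  bounded_linear_blocks[THEN bounded_linear.has_derivative]

lemmas continuous_blocks [continuous_intros] =
  bounded_linear_blocks[THEN bounded_linear.isCont]

lemmas has_derivative_matrix_vector [derivative_intros] =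
  matrix_vector_mul_bounded_linear[THEN bounded_linear.has_derivative]

lemmas has_derivative_nth [derivative_intros] =
  bounded_linear_vec_nth[THEN bounded_linear.has_derivative]

lemma block_zero_iff:
  fixes v :: "real ^ ('n::finite, 'l::finite, 'm::finite) uvar"
  shows "v = 0 \<longleftrightarrow> x_of v = 0 \<and> y_of v = 0 \<and> z_of v = 0 \<and> r_of v = 0 \<and> s_of v = 0 \<and>
    lam1_of v = 0 \<and> lam2_of v = 0 \<and> lam3_of v = 0 \<and> lam4_of v = 0 \<and> lam5_of v = 0 \<and>
    lam6_of v = 0 \<and> lam7_of v = 0"
  (is "_ \<longleftrightarrow> ?R")
proof
  assume R: ?R
  have "v $ i = 0" for i
    using R
    by (cases i) (simp_all add: vec_eq_iff x_of_def y_of_def z_of_def r_of_def s_of_def lam1_of_def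
        lam2_of_def lam3_of_def lam4_of_def lam5_of_def lam6_of_def lam7_of_def)
  then show "v = 0" by (simp add: vec_eq_iff)
qed (simp add: bounded_linear_blocks[THEN bounded_linear.linear, THEN linear_0])

section \<open>Gradients and Hessian block in terms of the total derivatives\<close>

text \<open>
  The Frechet derivatives of \<open>F\<close> on the product space are more convenient than its partial
  gradients: a component of a partial gradient is the first derivative evaluated at a fixed
  direction, so its derivative is read off the second derivative.
\<close>
lemma grad_x_eq:
  fixes F' :: "(real ^ 'n::finite) \<times> (real ^ 'n) \<Rightarrow> ((real ^ 'n) \<times> (real ^ 'n)) \<Rightarrow>\<^sub>L real"
  assumes "\<And>p. (F has_derivative blinfun_apply (F' p)) (at p)"
  shows "grad_x F x y = (\<chi> j. F' (x, y) (axis j 1, 0))"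
proof -
  have "((\<lambda>x'. F (x', y)) has_derivative (\<lambda>h. F' (x, y) (h, 0))) (at x)"
    by (rule has_derivative_compose[OF _ assms]) (auto intro!: derivative_eq_intros)
  then have "frechet_derivative (\<lambda>x'. F (x', y)) (at x) = (\<lambda>h. F' (x, y) (h, 0))"
    by (rule frechet_derivative_at[symmetric])
  then show ?thesis by (simp add: grad_x_def gradient_def)
qed

lemma grad_y_eq:
  fixes F' :: "(real ^ 'n::finite) \<times> (real ^ 'n) \<Rightarrow> ((real ^ 'n) \<times> (real ^ 'n)) \<Rightarrow>\<^sub>L real"
  assumes "\<And>p. (F has_derivative blinfun_apply (F' p)) (at p)"
  shows "grad_y F x y = (\<chi> j. F' (x, y) (0, axis j 1))"
proof -
  have "((\<lambda>y'. F (x, y')) has_derivative (\<lambda>h. F' (x, y) (0, h))) (at y)"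
    by (rule has_derivative_compose[OF _ assms]) (auto intro!: derivative_eq_intros)
  then have "frechet_derivative (\<lambda>y'. F (x, y')) (at y) = (\<lambda>h. F' (x, y) (0, h))"
    by (rule frechet_derivative_at[symmetric])
  then show ?thesis by (simp add: grad_y_def gradient_def)
qed

lemma has_derivative_directional:
  fixes F' :: "'a::real_normed_vector \<Rightarrow> 'a \<Rightarrow>\<^sub>L real"
  assumes F'': "\<And>p. (F' has_derivative blinfun_apply (F'' p)) (at p)"
    and g: "(g has_derivative g') (at p)"
  shows "((\<lambda>q. F' (g q) w) has_derivative (\<lambda>v. F'' (g p) (g' v) w)) (at p)"
proof -
  have "((\<lambda>q. F' (g q)) has_derivative (\<lambda>v. F'' (g p) (g' v))) (at p)"
    by (rule has_derivative_compose[OF g F''])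
  then show ?thesis
    by (rule bounded_linear.has_derivative[OF blinfun.bounded_linear_left])
qed

lemma hess_xx_mult:
  fixes F' :: "(real ^ 'n::finite) \<times> (real ^ 'n) \<Rightarrow> ((real ^ 'n) \<times> (real ^ 'n)) \<Rightarrow>\<^sub>L real"
  assumes F': "\<And>p. (F has_derivative blinfun_apply (F' p)) (at p)"
    and F'': "\<And>p. (F' has_derivative blinfun_apply (F'' p)) (at p)"
  shows "hess_xx F x y *v h = (\<chi> j. F'' (x, y) (h, 0) (axis j 1, 0))"
proof -
  let ?H = "\<lambda>h. \<chi> j. F'' (x, y) (h, 0) (axis j 1, 0)"
  have "((\<lambda>x'. F' (x', y) (axis j 1, 0)) has_derivative
      (\<lambda>h. F'' (x, y) (h, 0) (axis j 1, 0))) (at x)" for j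
    by (rule has_derivative_directional[OF F'']) (auto intro!: derivative_eq_intros)
  then have deriv: "((\<lambda>x'. grad_x F x' y) has_derivative ?H) (at x)"
    unfolding grad_x_eq[OF F']
    by (subst has_derivative_componentwise_within) (auto simp: Basis_vec_def inner_axis)
  then show ?thesis
    unfolding hess_xx_def jacobian_def frechet_derivative_at[OF deriv, symmetric]
    using has_derivative_linear[OF deriv] by (simp add: matrix_works)
qed

section \<open>The derivative of the smooth selection and its kernel\<close>

text \<open>
  \<open>H\<close> stands for the second derivative of \<open>F\<close> at the base point, through which alone the derivative
  of the selection depends on that point. The blocks \<open>(axis j 1, 0)\<close> and \<open>(0, axis j 1)\<close> pick out the
  rows of the Hessian belonging to the partial gradients in \<open>x\<close> and \<open>y\<close>.
\<close>
definition Phi_piece_deriv ::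
    "(((real ^ 'n::finite) \<times> (real ^ 'n)) \<Rightarrow>\<^sub>L (((real ^ 'n) \<times> (real ^ 'n)) \<Rightarrow>\<^sub>L real)) \<Rightarrow>
     real ^ 'n ^ 'm::finite \<Rightarrow> real ^ 'n ^ 'l::finite \<Rightarrow> real \<Rightarrow> (nat \<Rightarrow> real) \<Rightarrow>
     real ^ (('n, 'l, 'm) uvar) \<Rightarrow> real ^ (('n, 'l, 'm) eqn)"
  where "Phi_piece_deriv H D A \<alpha> t v = (\<chi> e. case e of
      Row1 j \<Rightarrow> H (x_of v, y_of v) (axis j 1, 0) + (transpose D *v lam1_of v + lam6_of v) $ j
    | Row2 j \<Rightarrow> H (x_of v, y_of v) (0, axis j 1) +
        (transpose A *v lam2_of v - \<alpha> *\<^sub>R (transpose A *v s_of v)) $ j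
    | Row3 j \<Rightarrow> (\<alpha> *\<^sub>R r_of v + A *v lam6_of v - lam3_of v) $ j
    | Row4 j \<Rightarrow> (\<alpha> *\<^sub>R z_of v + lam7_of v - lam4_of v) $ j
    | Row5 j \<Rightarrow> (lam7_of v - lam5_of v - \<alpha> *\<^sub>R (A *v y_of v)) $ j
    | Row6 j \<Rightarrow> (transpose A *v z_of v + x_of v) $ j
    | Row7 j \<Rightarrow> (r_of v + s_of v) $ j
    | Row8 j \<Rightarrow> lam1_of v $ j
    | Row9 j \<Rightarrow> - t 2 * (A *v y_of v) $ j
    | Row10 j \<Rightarrow> lam3_of v $ j
    | Row11 j \<Rightarrow> t 4 * r_of v $ j
    | Row12 j \<Rightarrow> lam5_of v $ j)"

text \<open>
  The system is triangular up to a permutation of rows and blocks. The hypothesis on \<open>H\<close> is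
  injectivity of the \<open>xx\<close>-block of the Hessian; it applies once \<open>y\<close>, \<open>\<lambda>\<^sub>1\<close> and \<open>\<lambda>\<^sub>6\<close> are known to
  vanish, since then the first row has no other term. The remaining blocks of the Hessian only
  ever multiply blocks of the vector that have been eliminated before.
\<close>
lemma Phi_piece_deriv_trivial_kernel:
  fixes D :: "real ^ 'n::finite ^ 'm::finite" and A :: "real ^ 'n ^ 'l::finite"
    and H :: "((real ^ 'n) \<times> (real ^ 'n)) \<Rightarrow>\<^sub>L (((real ^ 'n) \<times> (real ^ 'n)) \<Rightarrow>\<^sub>L real)"
  assumes "t 2 \<noteq> 0" "t 4 \<noteq> 0"
    and "invertible A"
    and H: "\<And>h. (\<chi> j. H (h, 0) (axis j 1, 0)) = (0 :: real ^ 'n) \<Longrightarrow> h = 0"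
    and v: "Phi_piece_deriv H D A \<alpha> t v = 0"
  shows "v = 0"
proof -
  obtain B where B: "A ** B = mat 1" "B ** A = mat 1"
    using \<open>invertible A\<close> unfolding invertible_def by blast
  have A0: "w = 0" if "A *v w = 0" for w
    using B(2) that matrix_left_invertible_ker by blast
  have "transpose B ** transpose A = mat 1"
    by (simp add: B(1) flip: matrix_transpose_mul)
  then have At0: "w = 0" if "transpose A *v w = 0" for w
    using that matrix_left_invertible_ker by blast
  have row: "Phi_piece_deriv H D A \<alpha> t v $ e = 0" for e
    by (simp add: v)
  have l1: "lam1_of v = 0" using row[of "Row8 _"] by (simp add: Phi_piece_deriv_def vec_eq_iff)
  have l3: "lam3_of v = 0" using row[of "Row10 _"] by (simp add: Phi_piece_deriv_def vec_eq_iff)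
  have l5: "lam5_of v = 0" using row[of "Row12 _"] by (simp add: Phi_piece_deriv_def vec_eq_iff)
  have r: "r_of v = 0" using row[of "Row11 _"] \<open>t 4 \<noteq> 0\<close> by (simp add: Phi_piece_deriv_def vec_eq_iff)
  have "A *v y_of v = 0" using row[of "Row9 _"] \<open>t 2 \<noteq> 0\<close> by (simp add: Phi_piece_deriv_def vec_eq_iff)
  then have y: "y_of v = 0" by (rule A0)
  have s: "s_of v = 0" using row[of "Row7 _"] r by (simp add: Phi_piece_deriv_def vec_eq_iff)
  have "A *v lam6_of v = 0" using row[of "Row3 _"] r l3 by (simp add: Phi_piece_deriv_def vec_eq_iff)
  then have l6: "lam6_of v = 0" by (rule A0)
  have l7: "lam7_of v = 0" using row[of "Row5 _"] y l5 by (simp add: Phi_piece_deriv_def vec_eq_iff)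
  have "(\<chi> j. H (x_of v, 0) (axis j 1, 0)) = 0"
    using row[of "Row1 _"] y l1 l6 by (simp add: Phi_piece_deriv_def vec_eq_iff)
  then have x: "x_of v = 0" by (rule H)
  have "transpose A *v z_of v = 0" using row[of "Row6 _"] x by (simp add: Phi_piece_deriv_def vec_eq_iff)
  then have z: "z_of v = 0" by (rule At0)
  have l4: "lam4_of v = 0" using row[of "Row4 _"] z l7 by (simp add: Phi_piece_deriv_def vec_eq_iff)
  have "transpose A *v lam2_of v = 0"
    using row[of "Row2 _"] x y s
    by (simp add: Phi_piece_deriv_def vec_eq_iff zero_prod_def[symmetric])
  then have l2: "lam2_of v = 0" by (rule At0)
  show ?thesis
    by (simp add: block_zero_iff x y z r s l1 l2 l3 l4 l5 l6 l7)
qed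

section \<open>The smooth selection where no maximum has argument zero\<close>

lemma eventually_strict_signs:
  fixes g :: "'a::t2_space \<Rightarrow> real ^ 'k::finite"
  assumes "isCont g u"
  shows "(\<forall>j. g u $ j < 0) \<Longrightarrow> \<forall>\<^sub>F p in nhds u. \<forall>j. g p $ j < 0"
    and "(\<forall>j. g u $ j > 0) \<Longrightarrow> \<forall>\<^sub>F p in nhds u. \<forall>j. g p $ j > 0"
proof -
  have "((\<lambda>p. g p $ j) \<longlongrightarrow> g u $ j) (nhds u)" for j
    using assms by (intro tendsto_vec_nth) (simp add: continuous_at tendsto_nhds_iff)
  then show "(\<forall>j. g u $ j < 0) \<Longrightarrow> \<forall>\<^sub>F p in nhds u. \<forall>j. g p $ j < 0"
    and "(\<forall>j. g u $ j > 0) \<Longrightarrow> \<forall>\<^sub>F p in nhds u. \<forall>j. g p $ j > 0"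
    by (auto intro!: eventually_all_finite order_tendstoD)
qed

text \<open>
  The signs of the five arguments of \<open>max0\<close> in \<open>Phi\<close>: negative where the maximum is to vanish,
  positive where it is to be its argument. They express that \<open>P\<^sub>1\<close>, \<open>P\<^sub>3\<close>, \<open>P\<^sub>5\<close>, \<open>Q\<^sub>2\<close> and \<open>Q\<^sub>4\<close> are empty.
\<close>
definition strict_sign_pattern ::
    "real ^ 'n::finite ^ 'm::finite \<Rightarrow> real ^ 'm \<Rightarrow> real ^ 'n ^ 'l::finite \<Rightarrow> real ^ 'l \<Rightarrow>
     (nat \<Rightarrow> real) \<Rightarrow> real ^ (('n, 'l, 'm) uvar) \<Rightarrow> bool"
  where "strict_sign_pattern D d A b t u \<longleftrightarrow>
    (\<forall>j. (lam1_of u + t 1 *\<^sub>R (D *v x_of u - d)) $ j < 0) \<and>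
    (\<forall>j. (lam2_of u + t 2 *\<^sub>R (A *v y_of u - b)) $ j > 0) \<and>
    (\<forall>j. (lam3_of u - t 3 *\<^sub>R z_of u) $ j < 0) \<and>
    (\<forall>j. (lam4_of u - t 4 *\<^sub>R r_of u) $ j > 0) \<and>
    (\<forall>j. (lam5_of u - t 5 *\<^sub>R s_of u) $ j < 0)"

lemma eventually_strict_sign_pattern:
  assumes "strict_sign_pattern D d A b t u"
  shows "\<forall>\<^sub>F p in nhds u. strict_sign_pattern D d A b t p"
  using assms unfolding strict_sign_pattern_def eventually_conj_iff
  by (intro conjI eventually_strict_signs)
    (auto intro!: continuous_intros matrix_vector_mul_bounded_linear[THEN bounded_linear.isCont])

text \<open>
  \<open>Phi\<close> with each maximum resolved according to that pattern. In the second and fourth multiplier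
  rows the multiplier cancels, which leaves a multiple of the constraint function itself.
\<close>
definition Phi_piece ::
    "((real ^ 'n::finite) \<times> (real ^ 'n) \<Rightarrow> real) \<Rightarrow> real ^ 'n ^ 'm::finite \<Rightarrow>
     real ^ 'n ^ 'l::finite \<Rightarrow> real ^ 'l \<Rightarrow> real \<Rightarrow> (nat \<Rightarrow> real) \<Rightarrow>
     real ^ (('n, 'l, 'm) uvar) \<Rightarrow> real ^ (('n, 'l, 'm) eqn)"
  where "Phi_piece F D A b \<alpha> t u = (\<chi> e. case e of
      Row1 j \<Rightarrow> (grad_x F (x_of u) (y_of u) + transpose D *v lam1_of u + lam6_of u) $ j
    | Row2 j \<Rightarrow> (grad_y F (x_of u) (y_of u) - \<alpha> *\<^sub>R (transpose A *v s_of u) +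
        transpose A *v lam2_of u) $ j
    | Row3 j \<Rightarrow> (\<alpha> *\<^sub>R r_of u + A *v lam6_of u - lam3_of u) $ j
    | Row4 j \<Rightarrow> (\<alpha> *\<^sub>R z_of u + lam7_of u - lam4_of u) $ j
    | Row5 j \<Rightarrow> (\<alpha> *\<^sub>R (b - A *v y_of u) + lam7_of u - lam5_of u) $ j
    | Row6 j \<Rightarrow> (transpose A *v z_of u + x_of u) $ j
    | Row7 j \<Rightarrow> (r_of u + s_of u - 1) $ j
    | Row8 j \<Rightarrow> lam1_of u $ j
    | Row9 j \<Rightarrow> - t 2 * (A *v y_of u - b) $ j
    | Row10 j \<Rightarrow> lam3_of u $ j
    | Row11 j \<Rightarrow> t 4 * r_of u $ j
    | Row12 j \<Rightarrow> lam5_of u $ j)"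

lemma Phi_eq_piece:
  assumes "strict_sign_pattern D d A b t u"
  shows "Phi F D d A b \<alpha> t u = Phi_piece F D A b \<alpha> t u"
proof -
  have neg: "max 0 c = 0" if "c < 0" for c :: real using that by simp
  have pos: "max 0 c = c" if "c > 0" for c :: real using that by simp
  show ?thesis
    using assms unfolding strict_sign_pattern_def Phi_def Phi_piece_def Let_def vec_eq_iff max0_def
    by (auto simp: neg pos simp del: vector_add_component vector_minus_component
        vector_scaleR_component split: eqn.split) simp_all
qed

lemma has_derivative_Phi_piece:
  fixes F' :: "(real ^ 'n::finite) \<times> (real ^ 'n) \<Rightarrow> ((real ^ 'n) \<times> (real ^ 'n)) \<Rightarrow>\<^sub>L real"
    and D :: "real ^ 'n ^ 'm::finite" and A :: "real ^ 'n ^ 'l::finite"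
  assumes F': "\<And>p. (F has_derivative blinfun_apply (F' p)) (at p)"
    and F'': "\<And>p. (F' has_derivative blinfun_apply (F'' p)) (at p)"
  shows "(Phi_piece F D A b \<alpha> t has_derivative Phi_piece_deriv (F'' (x_of p, y_of p)) D A \<alpha> t) (at p)"
proof -
  have dir: "((\<lambda>q. F' (x_of q, y_of q) w) has_derivative
      (\<lambda>v. F'' (x_of p, y_of p) (x_of v, y_of v) w)) (at p)"
    for w and p :: "real ^ ('n, 'l, 'm) uvar"
    by (rule has_derivative_directional[OF F'']) (auto intro!: derivative_eq_intros)
  have "((\<lambda>q. Phi_piece F D A b \<alpha> t q $ e) has_derivative
      (\<lambda>v. Phi_piece_deriv (F'' (x_of p, y_of p)) D A \<alpha> t v $ e)) (at p)" for e
    \<comment> \<open>The rule \<open>dir\<close> must come first, before the general rule for \<open>blinfun_apply\<close>,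
      so that the terms from \<open>F\<close> get the derivative in the form used by \<open>Phi_piece_deriv\<close>.\<close>
    by (cases e; simp only: Phi_piece_def Phi_piece_deriv_def grad_x_eq[OF F'] grad_y_eq[OF F'] eqn.case
        vec_lambda_beta vector_add_component vector_minus_component vector_scaleR_component;
        (rule dir derivative_eq_intros refl)+; simp add: fun_eq_iff algebra_simps)
  then show ?thesis
    by (subst has_derivative_componentwise_within) (auto simp: Basis_vec_def inner_axis)
qed

text \<open>
  Only the entries in the first two rows of this matrix vary with the base point, and they are
  values of \<open>H\<close> at fixed directions.
\<close>
lemma isCont_matrix_Phi_piece_deriv:
  fixes D :: "real ^ 'n::finite ^ 'm::finite" and A :: "real ^ 'n ^ 'l::finite"
    and H :: "_ \<Rightarrow> ((real ^ 'n) \<times> (real ^ 'n)) \<Rightarrow>\<^sub>L (((real ^ 'n) \<times> (real ^ 'n)) \<Rightarrow>\<^sub>L real)"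
  assumes "isCont H p"
  shows "isCont (\<lambda>q. matrix (Phi_piece_deriv (H q) D A \<alpha> t)) p"
  unfolding isCont_def
proof (intro vec_tendstoI)
  fix e :: "('n, 'l, 'm) eqn" and i :: "('n, 'l, 'm) uvar"
  show "((\<lambda>q. matrix (Phi_piece_deriv (H q) D A \<alpha> t) $ e $ i) \<longlongrightarrow>
      matrix (Phi_piece_deriv (H p) D A \<alpha> t) $ e $ i) (at p)"
    by (cases e)
      (auto simp: matrix_def Phi_piece_deriv_def intro!: tendsto_intros assms[unfolded isCont_def])
qed

theorem theorem4p5:
  fixes F :: "(real ^ 'n::finite) \<times> (real ^ 'n) \<Rightarrow> real"
    and D :: "real ^ 'n ^ 'm::finite" and d :: "real ^ 'm"
    and A :: "real ^ 'n ^ 'l::finite" and b :: "real ^ 'l"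
    and \<alpha> :: real and t :: "nat \<Rightarrow> real"
    and u :: "real ^ (('n, 'l, 'm) uvar)"
  assumes "twice_continuously_differentiable F"
    and "\<alpha> > 0"
    and "\<forall>i\<in>{1..5}. t i > 0"
    and "OC F D d A b \<alpha> u"
    and "CARD('l) = CARD('n)"
    and "invertible A"
    and "rank (hess_xx F (x_of u) (y_of u)) = CARD('n)"
    and "P_set (t 1) (lam1_of u) (D *v x_of u - d) = {}"
    and "P_set (t 3) (lam3_of u) (- z_of u) = {}"
    and "P_set (t 5) (lam5_of u) (- s_of u) = {}"
    and "Q_set (t 2) (lam2_of u) (A *v y_of u - b) = {}"
    and "Q_set (t 4) (lam4_of u) (- r_of u) = {}"
  shows "\<forall>J \<in> clarke_jacobian (Phi F D d A b \<alpha> t) u. invertible J"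
proof -
  obtain F' F'' where
    F': "\<And>p. (F has_derivative blinfun_apply (F' p)) (at p)" and
    F'': "\<And>p. (F' has_derivative blinfun_apply (F'' p)) (at p)" and
    cont: "continuous_on UNIV F''"
    using assms(1) unfolding twice_continuously_differentiable_def by blast
  define M where "M p = matrix (Phi_piece_deriv (F'' (x_of p, y_of p)) D A \<alpha> t)"
    for p :: "real ^ ('n, 'l, 'm) uvar"
  have deriv_matrix: "Phi_piece_deriv (F'' (x_of p, y_of p)) D A \<alpha> t = (*v) (M p)" for p
    unfolding M_def
    by (rule matrix_vector_mul(3)[symmetric])
      (rule has_derivative_bounded_linear[OF has_derivative_Phi_piece[OF F' F'']])
  have signs: "strict_sign_pattern D d A b t u"
    using assms(8-12) by (auto simp: strict_sign_pattern_def P_set_def Q_set_def not_le)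
  \<comment> \<open>Differentiability at \<open>p\<close> needs the two functions to agree on a neighbourhood of \<open>p\<close>.\<close>
  have "\<forall>\<^sub>F p in nhds u. \<forall>\<^sub>F q in nhds p. strict_sign_pattern D d A b t q"
    using eventually_strict_sign_pattern[OF signs] by (simp add: eventually_eventually)
  then have deriv: "\<forall>\<^sub>F p in nhds u. (Phi F D d A b \<alpha> t has_derivative (*v) (M p)) (at p)"
  proof eventually_elim
    case (elim p)
    then have eq: "\<forall>\<^sub>F q in nhds p. Phi_piece F D A b \<alpha> t q = Phi F D d A b \<alpha> t q"
      by eventually_elim (rule Phi_eq_piece[symmetric])
    have "(Phi_piece F D A b \<alpha> t has_derivative (*v) (M p)) (at p)"
      unfolding deriv_matrix[symmetric] by (rule has_derivative_Phi_piece[OF F' F''])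
    then show ?case
    proof (rule has_derivative_transform_eventually)
      show "\<forall>\<^sub>F q in at p. Phi_piece F D A b \<alpha> t q = Phi F D d A b \<alpha> t q"
        using eq by (simp add: eventually_at_filter eventually_mono)
    qed (use eventually_nhds_x_imp_x[OF eq] in auto)
  qed
  have "isCont (\<lambda>p. F'' (x_of p, y_of p)) u"
    using cont
    by (intro isCont_o2[of _ "\<lambda>p. (x_of p, y_of p)" F''])
      (auto intro!: continuous_intros simp: continuous_on_eq_continuous_at)
  then have "isCont M u"
    unfolding M_def by (rule isCont_matrix_Phi_piece_deriv)
  then have clarke: "clarke_jacobian (Phi F D d A b \<alpha> t) u = {M u}"
    by (rule clarke_jacobian_continuously_differentiable[OF deriv])
  have hess: "h = 0" if "(\<chi> j. F'' (x_of u, y_of u) (h, 0) (axis j 1, 0)) = (0 :: real ^ 'n)" for h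
  proof -
    have "inj ((*v) (hess_xx F (x_of u) (y_of u)))"
      using assms(7) by (simp add: full_rank_injective)
    moreover have "hess_xx F (x_of u) (y_of u) *v h = hess_xx F (x_of u) (y_of u) *v 0"
      using that by (simp add: hess_xx_mult[OF F' F''])
    ultimately show ?thesis by (rule injD)
  qed
  have "t 2 \<noteq> 0" "t 4 \<noteq> 0" using assms(3)[THEN bspec, of 2] assms(3)[THEN bspec, of 4] by auto
  then have ker: "v = 0" if "M u *v v = 0" for v
    using that assms(6) hess
    by (intro Phi_piece_deriv_trivial_kernel[of t A "F'' (x_of u, y_of u)" D \<alpha>])
      (simp_all add: deriv_matrix)
  have "CARD(('n, 'l, 'm) uvar) = CARD(('n, 'l, 'm) eqn)"
    by (simp only: CARD_uvar CARD_eqn)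
  then have "invertible (M u)"
    using ker by (rule invertible_if_trivial_kernel)
  then show ?thesis by (simp add: clarke)
qed

end
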